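(* Assume the reduced optimal load control problem is feasible, and that for every $i\in\mathcal N$ the function $c_i:\mathbb R\to\mathbb R$ is twice differentiable with $u\le c_i''(s)\le\ell$ for all $s\in\mathbb R$, where $0<u\le\ell$. Let $x^*$ be an equilibrium point of the reduced ALC dynamics (RD) and let $\mathcal S$ be the associated equilibrium set. Then the dynamics (RD) globally exponentially converge to $\mathcal S$: there is a constant $\rho_0>0$ such that for every solution $x(t)$, $t\ge 0$, of (RD) there is a constant $C_0\ge0$ (depending on the initial state) with $$\operatorname{dist}(x(t),\mathcal S)\le C_0\,e^{-\rho_0t},\qquad\forall t\ge0 .$$
   Context: **Network.** $G(\mathcal N,\mathcal E)$ is a finite connected directed graph with arbitrary line orientations (if $ij\in\mathcal E$ then $ji\notin\mathcal E$); $\mathcal N=\mathcal G\cup\mathcal L$ (disjoint: generator buses, load buses). The buses are grouped into control areas (a partition of $\mathcal N$), and $\mathcal E_{in}\subset\mathcal E$ is the set of lines joining buses of the same area. $A\in\mathbb R^{\mathcal N\times\mathcal E}$ is the node-branch incidence matrix (the column of line $ij$ has $+1$ in row $i$, $-1$ in row $j$, zero elsewhere); $\bar A$ consists of the columns of $A$ indexed by $\mathcal E_{in}$; $\bar B=\mathrm{diag}(B_{ij})_{ij\in\mathcal E_{in}}$ with $B_{ij}>0$; $S:=\bar A\bar B\bar A^\top$; $D=\mathrm{diag}(D_i)_{i\in\mathcal N}$ with $D_i>0$. Ordering generator buses first, write $A=[A_{\mathcal G};A_{\mathcal L}]$, $D=\mathrm{blockdiag}(D_{\mathcal G},D_{\mathcal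 L})$, $d=[d_{\mathcal G};d_{\mathcal L}]$, $\omega=[\omega_{\mathcal G};\omega_{\mathcal L}]$, $P^{in}=[P^{in}_{\mathcal G};P^{in}_{\mathcal L}]$, where $P^{in}\in\mathbb R^{\mathcal N}$ is fixed. Let $c(d)=\sum_{i\in\mathcal N}c_i(d_i)$, $\nabla c(d)=(c_i'(d_i))_{i\in\mathcal N}$. **Reduced optimal load control problem** (capacity constraints ignored): minimize $c(d)+\frac12\omega^\top D\omega$ over $d,\omega,\psi\in\mathbb R^{\mathcal N}$, $P\in\mathbb R^{\mathcal E}$ subject to $d=P^{in}-D\omega-AP$ and $d=P^{in}-S\psi$. **(RD)** With positive definite diagonal step-size matrices $\Xi_d,\Xi_P,\Xi_\psi,\Xi_\omega,\Xi_\mu$: $0=d_{\mathcal L}-P^{in}_{\mathcal L}+D_{\mathcal L}\omega_{\mathcal L}+A_{\mathcal L}P$, $\dot d=\Xi_d(-\nabla c(d)+\omega+\mu)$, $\dot P=\Xi_PA^\top\omega$, $\dot\psi=\Xi_\psi S\mu$, $\dot\omega_{\mathcal G}=\Xi_\omega(-d_{\mathcal G}-D_{\mathcal G}\omega_{\mathcal G}-A_{\mathcal G}P+P^{in}_{\mathcal G})$, $\dot\mu=\Xi_\mu(-d-S\psi+P^{in})$. The state is $x=[z;\omega_{\mathcal L}]$ with $z=[d;P;\psi;\omega_{\mathcal G};\mu]$. For an equilibrium point $x^*=[z^*;\omega^*_{\mathcal L}]$ of (RD), with $z^*=[d^*;P^*;\psi^*;\omega^*_{\mathcal G};\mu^*]$,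 $$\mathcal S=\{x:\ d=d^*,\ \omega_{\mathcal G}=\omega_{\mathcal G}^*,\ \omega_{\mathcal L}=\omega_{\mathcal L}^*,\ \mu=\mu^*,\ AP=AP^*,\ S\psi=S\psi^*\},$$ and $\operatorname{dist}(x,\mathcal S)=\inf_{\hat x\in\mathcal S}\|x-\hat x\|$ (Euclidean norm). *)

theory Defs
  imports "HOL-Analysis.Analysis" "HOL-Library.Disjoint_Sets"
begin

text \<open>
  The set of buses is the whole finite type \<open>'n\<close>. Lines are ordered pairs of buses, and
  \<open>\<real>\<^sup>E\<close> for a set of lines \<open>E\<close> is the coordinate subspace of \<^typ>\<open>real ^ ('n \<times> 'n)\<close> of the
  vectors supported on \<open>E\<close> (so \<open>E\<close> may be empty). Accordingly, a matrix indexed by \<open>E\<close> has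
  its entries outside \<open>E\<close> ignored or set to \<open>0\<close>, and \<open>\<real>\<^sup>G\<close> for a set of buses \<open>G\<close> is handled
  in the same way.
\<close>

definition coord_space :: "'i::finite set \<Rightarrow> (real ^ 'i) set" where
  "coord_space I = {v. \<forall>i. i \<notin> I \<longrightarrow> v $ i = 0}"

definition restr :: "'i::finite set \<Rightarrow> real ^ 'i \<Rightarrow> real ^ 'i" where
  "restr I v = (\<chi> i. if i \<in> I then v $ i else 0)"

definition diag :: "real ^ 'i::finite \<Rightarrow> real ^ 'i ^ 'i" where
  "diag v = (\<chi> i j. if i = j then v $ i else 0)"

definition pos_def_diagonal_on :: "'i::finite set \<Rightarrow> real ^ 'i ^ 'i \<Rightarrow> bool" where
  "pos_def_diagonal_on I X \<longleftrightarrow>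
     (\<forall>i j. i \<noteq> j \<longrightarrow> X $ i $ j = 0) \<and>
     (\<forall>v\<in>coord_space I. v \<noteq> 0 \<longrightarrow> 0 < v \<bullet> (X *v v))"

text \<open>
  \<open>line_susc\<close> holds the line parameters \<open>B\<^bsub>ij\<^esub>\<close>, of which only those of the lines inside an
  area are used. The fields \<open>Xi_d\<close> to \<open>Xi_mu\<close> are the step-size matrices.
\<close>

record 'n alc =
  gens :: "'n set"
  loads :: "'n set"
  lines :: "('n \<times> 'n) set"
  areas :: "'n set set"
  line_susc :: "real ^ ('n \<times> 'n)"
  damping :: "real ^ 'n"
  injection :: "real ^ 'n"
  cost :: "'n \<Rightarrow> real \<Rightarrow> real"
  Xi_d :: "real ^ 'n ^ 'n"
  Xi_P :: "real ^ ('n \<times> 'n) ^ ('n \<times> 'n)"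
  Xi_psi :: "real ^ 'n ^ 'n"
  Xi_omega :: "real ^ 'n ^ 'n"
  Xi_mu :: "real ^ 'n ^ 'n"

definition inner_lines :: "'n::finite alc \<Rightarrow> ('n \<times> 'n) set" where
  "inner_lines N = {(i, j) \<in> lines N. \<exists>K\<in>areas N. i \<in> K \<and> j \<in> K}"

definition alc_network :: "'n::finite alc \<Rightarrow> bool" where
  "alc_network N \<longleftrightarrow>
     gens N \<union> loads N = UNIV \<and> gens N \<inter> loads N = {} \<and>
     (\<forall>i j. (i, j) \<in> lines N \<longrightarrow> (j, i) \<notin> lines N) \<and>
     (\<forall>i j. (i, j) \<in> (lines N \<union> (lines N)\<inverse>)\<^sup>*) \<and>
     partition_on UNIV (areas N) \<and>
     (\<forall>e\<in>inner_lines N. 0 < line_susc N $ e) \<and>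
     (\<forall>i. 0 < damping N $ i) \<and>
     pos_def_diagonal_on UNIV (Xi_d N) \<and>
     pos_def_diagonal_on (lines N) (Xi_P N) \<and>
     pos_def_diagonal_on UNIV (Xi_psi N) \<and>
     pos_def_diagonal_on (gens N) (Xi_omega N) \<and>
     pos_def_diagonal_on UNIV (Xi_mu N)"

definition incidence :: "('n \<times> 'n) set \<Rightarrow> real ^ ('n \<times> 'n) ^ 'n::finite" where
  "incidence E = (\<chi> v e.
     if e \<in> E then (if v = fst e then 1 else if v = snd e then -1 else 0) else 0)"

definition mat_A :: "'n::finite alc \<Rightarrow> real ^ ('n \<times> 'n) ^ 'n" where
  "mat_A N = incidence (lines N)"

definition mat_D :: "'n::finite alc \<Rightarrow> real ^ 'n ^ 'n" where
  "mat_D N = diag (damping N)"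

definition mat_S :: "'n::finite alc \<Rightarrow> real ^ 'n ^ 'n" where
  "mat_S N = incidence (inner_lines N) ** diag (line_susc N)
               ** transpose (incidence (inner_lines N))"

definition grad_cost :: "'n::finite alc \<Rightarrow> real ^ 'n \<Rightarrow> real ^ 'n" where
  "grad_cost N d = (\<chi> i. deriv (cost N i) (d $ i))"

definition reduced_olc_feasible :: "'n::finite alc \<Rightarrow> bool" where
  "reduced_olc_feasible N \<longleftrightarrow>
     (\<exists>d \<omega> \<psi>. \<exists>P\<in>coord_space (lines N).
        d = injection N - mat_D N *v \<omega> - mat_A N *v P \<and>
        d = injection N - mat_S N *v \<psi>)"

text \<open>
  A state is \<open>(d, P, \<psi>, \<omega>, \<mu>)\<close>, where \<open>\<omega>\<close> comprises both \<open>\<omega>\<^sub>G\<close> and \<open>\<omega>\<^sub>L\<close>. The norm of the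
  product type is the Euclidean norm of the stacked vector.
\<close>

type_synonym 'n state =
  "(real ^ 'n) \<times> (real ^ ('n \<times> 'n)) \<times> (real ^ 'n) \<times> (real ^ 'n) \<times> (real ^ 'n)"

definition states :: "'n::finite alc \<Rightarrow> 'n state set" where
  "states N = {(d, P, \<psi>, \<omega>, \<mu>). P \<in> coord_space (lines N)}"

text \<open>The differential part \<open>z\<close> of a state: \<open>\<omega>\<^sub>L\<close> is set to \<open>0\<close>.\<close>

fun diff_part :: "'n::finite alc \<Rightarrow> 'n state \<Rightarrow> 'n state" where
  "diff_part N (d, P, \<psi>, \<omega>, \<mu>) = (d, P, \<psi>, restr (gens N) \<omega>, \<mu>)"

fun rd_balance :: "'n::finite alc \<Rightarrow> 'n state \<Rightarrow> bool" where
  "rd_balance N (d, P, \<psi>, \<omega>, \<mu>) \<longleftrightarrow>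
     0 = restr (loads N) (d - injection N + mat_D N *v \<omega> + mat_A N *v P)"

fun rd_field :: "'n::finite alc \<Rightarrow> 'n state \<Rightarrow> 'n state" where
  "rd_field N (d, P, \<psi>, \<omega>, \<mu>) =
     (Xi_d N *v (- grad_cost N d + \<omega> + \<mu>),
      Xi_P N *v (transpose (mat_A N) *v \<omega>),
      Xi_psi N *v (mat_S N *v \<mu>),
      Xi_omega N *v restr (gens N) (- d - mat_D N *v \<omega> - mat_A N *v P + injection N),
      Xi_mu N *v (- d - mat_S N *v \<psi> + injection N))"

definition rd_solution :: "'n::finite alc \<Rightarrow> (real \<Rightarrow> 'n state) \<Rightarrow> bool" where
  "rd_solution N x \<longleftrightarrow>
     (\<forall>t\<ge>0. x t \<in> states N \<and> rd_balance N (x t) \<and>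
        ((\<lambda>s. diff_part N (x s)) has_vector_derivative rd_field N (x t)) (at t within {0..}))"

definition rd_equilibrium :: "'n::finite alc \<Rightarrow> 'n state \<Rightarrow> bool" where
  "rd_equilibrium N x \<longleftrightarrow> x \<in> states N \<and> rd_balance N x \<and> rd_field N x = 0"

fun equilibrium_set :: "'n::finite alc \<Rightarrow> 'n state \<Rightarrow> 'n state set" where
  "equilibrium_set N (d', P', \<psi>', \<omega>', \<mu>') =
     {(d, P, \<psi>, \<omega>, \<mu>) \<in> states N.
        d = d' \<and> \<omega> = \<omega>' \<and> \<mu> = \<mu>' \<and>
        mat_A N *v P = mat_A N *v P' \<and> mat_S N *v \<psi> = mat_S N *v \<psi>'}"

end

theory Submission
  imports Defs
begin

text \<open>
  Measured with the inverse step sizes as weights, half the squared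
  distance to an equilibrium is an energy in which all couplings between the variables cancel. It
  decreases through the strong convexity of the cost and the damping of the frequencies only
  (\<open>energy_rate\<close>), so it controls the loads \<open>d\<close> and the frequencies \<open>\<omega>\<close>. The remaining
  quantities make themselves felt through these: \<open>\<mu>\<close> drives \<open>d\<close>, \<open>A P\<close> drives the generator
  frequencies, and \<open>S \<psi>\<close> drives \<open>\<mu>\<close>. Adding a small multiple of the corresponding cross terms
  to the energy makes it decrease through them as well (\<open>coupling_rate\<close>), and Gronwall's inequality
  yields an exponential rate (\<open>exp_stability_by_strictified_energy\<close>) that depends on the network
  and on the bounds for the second derivatives of the costs only.

  Two points need care. First, only \<open>A P\<close> and \<open>S \<psi>\<close> become small, not \<open>P\<close> and \<open>\<psi>\<close>
  themselves. But \<open>P\<close> moves only in the range of \<open>\<Xi>\<^sub>P A\<^sup>T\<close>, a complement of the kernel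
  of \<open>A\<close>, on which the norm is controlled by that of \<open>A P\<close>; the same holds for \<open>\<psi>\<close> and \<open>S\<close>.
  The projection onto this complement along the kernel (\<open>weighted_partial_inverse\<close>) removes the
  motionless part of the deviation without affecting the equations of motion, and what it removes
  is exactly the freedom in the equilibrium set. Second, the load frequencies have no
  equation of motion, but the balance equation at the load buses supplies the same term to the
  dissipation and bounds them by the other variables (\<open>frequency_bounded_by_state\<close>).
\<close>

section \<open>Exponential decay from a strictified energy\<close>

text \<open>
  Gronwall's inequality: \<open>V t * exp (\<rho> * t)\<close> is nonincreasing.
\<close>

lemma exp_decay_of_derivative_bound:
  fixes V V' :: "real \<Rightarrow> real"
  assumes der: "\<And>t. t \<ge> 0 \<Longrightarrow> (V has_real_derivative V' t) (at t within {0..})"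
    and le: "\<And>t. t \<ge> 0 \<Longrightarrow> V' t \<le> - \<rho> * V t"
    and "t \<ge> 0"
  shows "V t \<le> V 0 * exp (- \<rho> * t)"
proof -
  define f where "f = (\<lambda>s. V s * exp (\<rho> * s))"
  have df: "(f has_real_derivative (V' s + \<rho> * V s) * exp (\<rho> * s)) (at s within {0..})" if "s \<ge> 0" for s
    unfolding f_def by (auto intro!: derivative_eq_intros der that simp: algebra_simps)
  have "f t \<le> f 0"
  proof (rule DERIV_nonpos_imp_decreasing_open[OF \<open>t \<ge> 0\<close>])
    fix s assume s: "0 < s" "s < t"
    have "at s within {0..} = at s"
      by (rule at_within_interior) (use s in auto)
    with df[of s] s have "(f has_real_derivative (V' s + \<rho> * V s) * exp (\<rho> * s)) (at s)" by simp
    moreover have "(V' s + \<rho> * V s) * exp (\<rho> * s) \<le> 0"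
      using le[of s] s by (intro mult_nonpos_nonneg) auto
    ultimately show "\<exists>y. DERIV f s :> y \<and> y \<le> 0" by blast
  next
    have "continuous (at s within {0..}) f" if "s \<ge> 0" for s
      using df[OF that] by (rule DERIV_continuous)
    then have "continuous_on {0..} f" by (simp add: continuous_on_eq_continuous_within)
    then show "continuous_on {0..t} f" by (rule continuous_on_subset) auto
  qed
  then have "V t * exp (\<rho> * t) * exp (- \<rho> * t) \<le> V 0 * exp (- \<rho> * t)"
    unfolding f_def by (intro mult_right_mono) auto
  then show ?thesis by (simp add: mult.assoc flip: exp_add)
qed

lemma has_real_derivative_quadratic_form:
  fixes B :: "'a::euclidean_space \<Rightarrow> 'a"
  assumes B: "linear B" and z: "(z has_vector_derivative z') (at t within T)"
  shows "((\<lambda>t. z t \<bullet> B (z t)) has_real_derivative (z' \<bullet> B (z t) + z t \<bullet> B z')) (at t within T)"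
proof -
  have "((\<lambda>t. B (z t)) has_vector_derivative B z') (at t within T)"
    using bounded_linear.has_vector_derivative[OF _ z] B by (simp add: linear_conv_bounded_linear)
  from bounded_bilinear.has_vector_derivative[OF bounded_bilinear_inner z this]
  show ?thesis by (simp add: has_real_derivative_iff_has_vector_derivative add.commute)
qed

lemma linear_inner_bound:
  fixes B :: "'a::euclidean_space \<Rightarrow> 'a"
  assumes "linear B"
  obtains K where "K > 0" "\<And>x. \<bar>x \<bullet> B x\<bar> \<le> K * (norm x)\<^sup>2"
proof -
  obtain K where K: "K > 0" "\<And>x. norm (B x) \<le> K * norm x"
    using linear_bounded_pos[OF assms] by blast
  have "\<bar>x \<bullet> B x\<bar> \<le> K * (norm x)\<^sup>2" for x
  proof -
    have "\<bar>x \<bullet> B x\<bar> \<le> norm x * norm (B x)" by (rule Cauchy_Schwarz_ineq2)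
    also have "\<dots> \<le> norm x * (K * norm x)" by (intro mult_left_mono K) auto
    finally show ?thesis by (simp add: power2_eq_square algebra_simps)
  qed
  with K(1) that show thesis by blast
qed

text \<open>
  By homogeneity it suffices to bound the form on the unit sphere, where it attains a positive
  minimum by compactness.
\<close>

lemma positive_definite_coercive:
  fixes W :: "'a::euclidean_space \<Rightarrow> 'a"
  assumes W: "linear W" and pos: "\<And>x. x \<noteq> 0 \<Longrightarrow> x \<bullet> W x > 0"
  obtains k where "k > 0" "\<And>x. k * (norm x)\<^sup>2 \<le> x \<bullet> W x"
proof -
  have "continuous_on (sphere 0 1) (\<lambda>x. x \<bullet> W x)"
    by (intro continuous_intros linear_continuous_on) (use W in \<open>simp add: linear_conv_bounded_linear\<close>)
  moreover have "sphere (0::'a) 1 \<noteq> {}" by simp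
  ultimately obtain y where y: "norm y = 1" "\<And>x. norm x = 1 \<Longrightarrow> y \<bullet> W y \<le> x \<bullet> W x"
    using continuous_attains_inf[OF compact_sphere, of 0 1 "\<lambda>x. x \<bullet> W x"] by auto
  have "(y \<bullet> W y) * (norm x)\<^sup>2 \<le> x \<bullet> W x" for x
  proof (cases "x = 0")
    case False
    have "y \<bullet> W y \<le> (x /\<^sub>R norm x) \<bullet> W (x /\<^sub>R norm x)" by (rule y) (use False in auto)
    also have "\<dots> = (x \<bullet> W x) / (norm x)\<^sup>2"
      using W by (simp add: linear_cmul power2_eq_square divide_inverse)
    finally show ?thesis using False by (simp add: field_simps)
  qed auto
  moreover have "y \<bullet> W y > 0" using pos[of y] y(1) by force
  ultimately show thesis using that by blast
qed

text \<open>
  The mechanism that turns a merely nonincreasing energy into an exponentially decaying one. The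
  energy \<open>x \<bullet> W x / 2\<close> dissipates only the part \<open>r\<close> of the state, while the indefinite form
  \<open>x \<bullet> B x\<close> decreases through the remaining part \<open>q\<close> at the price of some \<open>r\<close>. Adding a
  small multiple \<open>\<epsilon>\<close> of the latter leaves the energy equivalent to the squared norm, and the
  dissipation of \<open>r\<close> pays the price, so that the sum decreases through all of \<open>r + q\<close>, hence
  proportionally to itself. The two constants are chosen before the trajectory: this is what
  makes the rate common to all solutions.
\<close>

lemma exp_stability_by_strictified_energy:
  fixes W B :: "'a::euclidean_space \<Rightarrow> 'a"
  assumes W: "linear W" and sym: "\<And>x y. x \<bullet> W y = W x \<bullet> y"
    and pos: "\<And>x. x \<noteq> 0 \<Longrightarrow> x \<bullet> W x > 0" and B: "linear B"
    and c: "c > 0" "\<kappa> > 0" "K \<ge> 0" "M \<ge> 0"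
  shows "\<exists>\<rho>>0. \<exists>C\<ge>0. \<forall>z z' r q.
    (\<forall>t\<ge>0. (z has_vector_derivative z' t) (at t within {0..}) \<and> 0 \<le> r t \<and> 0 \<le> q t \<and>
       z t \<bullet> W (z' t) \<le> - c * r t \<and>
       z' t \<bullet> B (z t) + z t \<bullet> B (z' t) \<le> K * r t - \<kappa> * q t \<and>
       (norm (z t))\<^sup>2 \<le> M * (r t + q t))
    \<longrightarrow> (\<forall>t\<ge>0. norm (z t) \<le> C * norm (z 0) * exp (- \<rho> * t))"
proof -
  obtain k where k: "k > 0" "\<And>x. k * (norm x)\<^sup>2 \<le> x \<bullet> W x"
    using positive_definite_coercive[OF W pos] by blast
  obtain KW where KW: "KW > 0" "\<And>x. \<bar>x \<bullet> W x\<bar> \<le> KW * (norm x)\<^sup>2"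
    using linear_inner_bound[OF W] by blast
  obtain KB where KB: "KB > 0" "\<And>x. \<bar>x \<bullet> B x\<bar> \<le> KB * (norm x)\<^sup>2"
    using linear_inner_bound[OF B] by blast
  \<comment> \<open>The first bound keeps \<open>V\<close> coercive, the second keeps half of the dissipation of \<open>r\<close>.\<close>
  define \<epsilon> where "\<epsilon> = min (k / (4 * KB)) (c / (2 * (K + 1)))"
  have e: "\<epsilon> > 0" "\<epsilon> * KB \<le> k / 4" "\<epsilon> * K \<le> c / 2"
  proof -
    show "\<epsilon> > 0" using k KB c by (auto simp: \<epsilon>_def)
    have "\<epsilon> * KB \<le> k / (4 * KB) * KB" using KB by (intro mult_right_mono) (auto simp: \<epsilon>_def)
    then show "\<epsilon> * KB \<le> k / 4" using KB by simp
    have "\<epsilon> * K \<le> c / (2 * (K + 1)) * (K + 1)"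
      using c \<open>\<epsilon> > 0\<close> by (intro mult_mono) (auto simp: \<epsilon>_def)
    also have "\<dots> = c / 2" using c by (simp add: field_simps)
    finally show "\<epsilon> * K \<le> c / 2" .
  qed
  define V where "V = (\<lambda>x. x \<bullet> W x / 2 + \<epsilon> * (x \<bullet> B x))"
  define U where "U = KW / 2 + \<epsilon> * KB"
  define \<gamma> where "\<gamma> = min (c / 2) (\<epsilon> * \<kappa>)"
  \<comment> \<open>\<open>M + 1\<close> instead of \<open>M\<close> avoids a division by zero.\<close>
  define \<rho> where "\<rho> = \<gamma> / (U * (M + 1))"
  have U: "U > 0" using KW KB e by (auto simp: U_def intro!: add_pos_pos)
  have g: "\<gamma> > 0" using c e by (simp add: \<gamma>_def)
  have rho: "\<rho> > 0" using g U c by (auto simp: \<rho>_def)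
  have eB: "\<bar>\<epsilon> * (x \<bullet> B x)\<bar> \<le> \<epsilon> * (KB * (norm x)\<^sup>2)" for x
    using KB(2)[of x] e(1) by (simp add: abs_mult)
  have V_lower: "k / 4 * (norm x)\<^sup>2 \<le> V x" for x
  proof -
    have "\<epsilon> * KB * (norm x)\<^sup>2 \<le> k / 4 * (norm x)\<^sup>2" by (intro mult_right_mono e) auto
    then show ?thesis using eB[of x] k(2)[of x] by (simp add: V_def abs_le_iff algebra_simps)
  qed
  have V_upper: "V x \<le> U * (norm x)\<^sup>2" for x
    using eB[of x] KW(2)[of x] by (simp add: V_def U_def abs_le_iff algebra_simps)
  define C where "C = sqrt (4 * U / k)"
  have "norm (z t) \<le> C * norm (z 0) * exp (- (\<rho> / 2) * t)"
    if hyp: "\<forall>t\<ge>0. (z has_vector_derivative z' t) (at t within {0..}) \<and> 0 \<le> r t \<and> 0 \<le> q t \<and>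
        z t \<bullet> W (z' t) \<le> - c * r t \<and>
        z' t \<bullet> B (z t) + z t \<bullet> B (z' t) \<le> K * r t - \<kappa> * q t \<and>
        (norm (z t))\<^sup>2 \<le> M * (r t + q t)" and t: "t \<ge> 0"
    for z z' r q t
  proof -
    have z: "(z has_vector_derivative z' s) (at s within {0..})" and rq: "0 \<le> r s \<and> 0 \<le> q s"
      and energy: "z s \<bullet> W (z' s) \<le> - c * r s"
      and cross: "z' s \<bullet> B (z s) + z s \<bullet> B (z' s) \<le> K * r s - \<kappa> * q s"
      and zM: "(norm (z s))\<^sup>2 \<le> M * (r s + q s)" if "s \<ge> 0" for s
      using hyp that by blast+
    define V' where "V' = (\<lambda>t. (z' t \<bullet> W (z t) + z t \<bullet> W (z' t)) / 2
                               + \<epsilon> * (z' t \<bullet> B (z t) + z t \<bullet> B (z' t)))"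
    have der: "((\<lambda>t. V (z t)) has_real_derivative V' s) (at s within {0..})" if "s \<ge> 0" for s
      unfolding V_def V'_def
      by (intro derivative_intros DERIV_cmult has_real_derivative_quadratic_form W B z that DERIV_cdivide)
    have "V' s \<le> - \<rho> * V (z s)" if s: "s \<ge> 0" for s
    proof -
      have "V' s \<le> - c * r s + \<epsilon> * (K * r s - \<kappa> * q s)"
      proof -
        have "z' s \<bullet> W (z s) = z s \<bullet> W (z' s)" by (metis sym inner_commute)
        then show ?thesis unfolding V'_def using energy[OF s] cross[OF s] e(1)
          by (intro add_mono mult_left_mono) auto
      qed
      also have "\<dots> = (\<epsilon> * K) * r s - c * r s - (\<epsilon> * \<kappa>) * q s" by (simp add: algebra_simps)
      also have "\<dots> \<le> (c / 2) * r s - c * r s - \<gamma> * q s"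
        using rq[OF s] e by (intro diff_mono mult_right_mono) (auto simp: \<gamma>_def)
      also have "\<dots> \<le> - \<gamma> * (r s + q s)"
      proof -
        have "\<gamma> * r s \<le> (c / 2) * r s" using rq[OF s] by (intro mult_right_mono) (auto simp: \<gamma>_def)
        then show ?thesis by (simp add: algebra_simps)
      qed
      also have "\<dots> \<le> - \<rho> * V (z s)"
      proof -
        have "V (z s) \<le> U * ((M + 1) * (r s + q s))"
        proof -
          have "(norm (z s))\<^sup>2 \<le> (M + 1) * (r s + q s)"
            using zM[OF s] rq[OF s] by (simp add: algebra_simps)
          then show ?thesis using V_upper[of "z s"] U
            by (meson mult_left_mono order_trans less_imp_le)
        qed
        then have "\<rho> * V (z s) \<le> \<rho> * (U * ((M + 1) * (r s + q s)))"
          using rho by (intro mult_left_mono) auto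
        also have "\<dots> = \<gamma> * (r s + q s)" using U c by (simp add: \<rho>_def)
        finally show ?thesis by simp
      qed
      finally show ?thesis .
    qed
    from exp_decay_of_derivative_bound[of "\<lambda>t. V (z t)", OF der this t]
    have "V (z t) \<le> V (z 0) * exp (- \<rho> * t)" .
    with V_lower[of "z t"] have "k / 4 * (norm (z t))\<^sup>2 \<le> V (z 0) * exp (- \<rho> * t)" by linarith
    also have "\<dots> \<le> U * (norm (z 0))\<^sup>2 * exp (- \<rho> * t)"
      by (intro mult_right_mono V_upper) auto
    finally have "(norm (z t))\<^sup>2 \<le> 4 * U / k * (norm (z 0))\<^sup>2 * exp (- \<rho> * t)"
      using k by (simp add: field_simps)
    also have "\<dots> = (C * norm (z 0) * exp (- (\<rho> / 2) * t))\<^sup>2"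
    proof -
      have "(exp (- (\<rho> / 2) * t))\<^sup>2 = exp (- \<rho> * t)"
        by (simp add: power2_eq_square flip: exp_add)
      moreover have "C\<^sup>2 = 4 * U / k" using U k by (simp add: C_def)
      ultimately show ?thesis by (simp add: power_mult_distrib)
    qed
    finally show ?thesis
      by (rule power2_le_imp_le) (use U k in \<open>simp add: C_def\<close>)
  qed
  moreover have "0 < \<rho> / 2" "0 \<le> C" using rho U k by (simp_all add: C_def)
  ultimately show ?thesis by blast
qed

section \<open>Positive definite operators and partial inverses\<close>

lemma young_inequality: "x * y \<le> e * x\<^sup>2 + y\<^sup>2 / (4 * e)" if "e > 0" for x y e :: real
proof -
  have "0 \<le> (2 * e * x - y)\<^sup>2" by simp
  then show ?thesis using that by (simp add: field_simps power2_eq_square)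
qed

text \<open>
  A step-size operator \<open>X\<close> enters the flow, its inverse \<open>W\<close> enters the energy. Carrying both
  along avoids speaking of matrix inverses, and lets the step sizes that act on a coordinate
  subspace only be extended to the whole space.
\<close>

definition pos_def_inverse_pair :: "('a::euclidean_space \<Rightarrow> 'a) \<Rightarrow> ('a \<Rightarrow> 'a) \<Rightarrow> bool" where
  "pos_def_inverse_pair X W \<longleftrightarrow> linear X \<and> linear W \<and> (\<forall>x. W (X x) = x) \<and>
     (\<forall>x y. x \<bullet> W y = W x \<bullet> y) \<and> (\<forall>x. x \<noteq> 0 \<longrightarrow> 0 < x \<bullet> W x)"

lemma pos_def_inverse_pairD:
  assumes "pos_def_inverse_pair X W"
  shows "linear X" "linear W" "W (X x) = x" "x \<bullet> W y = W x \<bullet> y" "x \<noteq> 0 \<Longrightarrow> 0 < x \<bullet> W x"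
  using assms by (auto simp: pos_def_inverse_pair_def)

lemma pos_def_inverse_pair_definite:
  assumes XW: "pos_def_inverse_pair X W" and "x \<bullet> X x = 0"
  shows "x = 0"
proof (rule ccontr)
  assume "x \<noteq> 0"
  note D = pos_def_inverse_pairD[OF XW]
  have "X x \<noteq> 0" using D(3)[of x] D(2) \<open>x \<noteq> 0\<close> by (metis linear_0)
  then have "0 < X x \<bullet> W (X x)" by (rule D(5))
  with assms(2) show False by (simp add: D(3) inner_commute)
qed

text \<open>
  A state \<open>p\<close> with \<open>p' = X (At w)\<close> moves only inside the range of \<open>X \<circ> At\<close>. This range is a
  complement of the kernel of \<open>A\<close>: \<open>A\<close> is injective on it because
  \<open>A (X (At w)) \<bullet> w = At w \<bullet> X (At w)\<close> vanishes only if \<open>At w\<close> does, and it maps it onto the whole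
  range of \<open>A\<close>. Hence \<open>L \<circ> A\<close> is the projection onto the moving part along the kernel of
  \<open>A\<close>. Passing from \<open>p\<close> to \<open>L (A p)\<close> discards the motionless part of \<open>p\<close>, which need not
  agree with that of a given equilibrium, and keeps the equations of motion unchanged.
\<close>

lemma weighted_partial_inverse:
  fixes A :: "'b::euclidean_space \<Rightarrow> 'a::euclidean_space" and At :: "'a \<Rightarrow> 'b"
  assumes A: "linear A" and At: "linear At" and adj: "\<And>x y. A x \<bullet> y = x \<bullet> At y"
    and XW: "pos_def_inverse_pair X W"
  obtains L where "linear L" "\<And>y. L y \<in> range (\<lambda>w. X (At w))"
    "\<And>w. L (A (X (At w))) = X (At w)" "\<And>p. A (L (A p)) = A p"
proof -
  note D = pos_def_inverse_pairD[OF XW]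
  define R where "R = (\<lambda>w. X (At w))"
  have R: "linear R" using linear_compose[OF At D(1)] by (simp add: R_def o_def)
  have M: "linear (\<lambda>w. A (R w))" using linear_compose[OF R A] by (simp add: o_def)
  have ker: "At w = 0" if "A (R w) \<bullet> w = 0" for w
    using that adj[of "R w" w]
    by (intro pos_def_inverse_pair_definite[OF XW]) (simp add: R_def inner_commute[of "At w"])
  have "inj_on A (range R)"
  proof (rule inj_onI)
    fix x y assume xy: "x \<in> range R" "y \<in> range R" "A x = A y"
    then obtain a b where ab: "x = R a" "y = R b" by auto
    then have "A (R (a - b)) = 0" using xy by (simp add: linear_diff[OF A] linear_diff[OF R])
    then have "At (a - b) = 0" by (intro ker) simp
    then have "R (a - b) = 0" by (simp add: R_def linear_0[OF D(1)])
    then show "x = y" by (simp add: ab linear_diff[OF R])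
  qed
  from linear_exists_left_inverse_on[OF A linear_subspace_image[OF R subspace_UNIV] this]
  obtain L where L: "range L \<subseteq> range R" "linear L" "\<And>w. L (A (R w)) = R w" by auto
  have "A (L (A p)) = A p" for p
  proof -
    let ?T = "range (\<lambda>w. A (R w))"
    have T: "subspace ?T" by (rule linear_subspace_image[OF M subspace_UNIV])
    \<comment> \<open>The component of \<open>A p\<close> orthogonal to the range of \<open>A \<circ> R\<close> is killed by \<open>At\<close>, hence zero.\<close>
    obtain y z where yz: "y \<in> span ?T" "\<And>w. w \<in> span ?T \<Longrightarrow> orthogonal z w" "A p = y + z"
      using orthogonal_subspace_decomp_exists[of ?T "A p"] by blast
    then obtain w where w: "y = A (R w)" using T by (auto simp: span_eq_iff[THEN iffD2])
    have orth: "z \<bullet> A (R v) = 0" for v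
      using yz(2)[of "A (R v)"] by (auto simp: orthogonal_def intro: span_base)
    have "At z = 0" by (rule ker) (use orth[of z] in \<open>simp add: inner_commute\<close>)
    then have "A p \<bullet> z = 0" by (simp add: adj)
    then have "z = 0" using orth[of w] by (simp add: yz(3) w inner_left_distrib inner_right_distrib inner_commute)
    then have "A p = A (R w)" by (simp add: yz(3) w)
    then show ?thesis by (simp add: L(3))
  qed
  with L show thesis by (intro that[of L]) (auto simp: R_def)
qed

section \<open>Saddle flows with an algebraic constraint\<close>

text \<open>
  The deviation of a trajectory from an equilibrium, for abstract operators: \<open>d\<close> and \<open>m\<close> stand
  for the deviations of the loads and of the multipliers \<open>\<mu>\<close>, \<open>p\<close> and \<open>q\<close> for the moving parts
  of the line flows and of the virtual phase angles, \<open>w\<close> for the deviation of all frequencies and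
  \<open>g\<close> for that of the generator frequencies, the only ones with a dynamics of their own.
\<close>

locale saddle_flow =
  fixes Xd Wd Xq Wq Xg Wg Xm Wm :: "'a::euclidean_space \<Rightarrow> 'a"
    and Xp Wp :: "'b::euclidean_space \<Rightarrow> 'b"
    and A :: "'b \<Rightarrow> 'a" and At :: "'a \<Rightarrow> 'b" and S D :: "'a \<Rightarrow> 'a"
    and \<delta> :: real
  assumes pd: "pos_def_inverse_pair Xd Wd" "pos_def_inverse_pair Xp Wp" "pos_def_inverse_pair Xq Wq"
      "pos_def_inverse_pair Xg Wg" "pos_def_inverse_pair Xm Wm"
    and lin: "linear A" "linear At" "linear S" "linear D"
    and adj: "A p \<bullet> x = p \<bullet> At x" and S_sym: "S x \<bullet> y = x \<bullet> S y"
    and \<delta>: "0 < \<delta>" "\<delta> * (norm x)\<^sup>2 \<le> x \<bullet> D x"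
begin

text \<open>
  \<open>h\<close> stands for the difference of the cost gradients and is left free, as is \<open>w\<close>; they are
  constrained through \<open>admissible\<close> only.
\<close>

definition field :: "'a \<Rightarrow> 'a \<Rightarrow> 'a \<times> 'b \<times> 'a \<times> 'a \<times> 'a \<Rightarrow> 'a \<times> 'b \<times> 'a \<times> 'a \<times> 'a" where
  "field h w = (\<lambda>(d, p, q, g, m).
     (Xd (- h + w + m), Xp (At w), Xq (S m), - Xg (d + D w + A p), - Xm (d + S q)))"

text \<open>
  The bounds on \<open>h\<close> are strong convexity and Lipschitz continuity of the gradient. The equation
  for \<open>g\<close> encodes both the balance at the load buses, where the residual
  \<open>d + D w + A p\<close> vanishes, and the fact that \<open>g\<close> and \<open>w\<close> agree at the generator buses.
\<close>

definition admissible :: "real \<Rightarrow> real \<Rightarrow> 'a \<Rightarrow> 'a \<Rightarrow> 'a \<times> 'b \<times> 'a \<times> 'a \<times> 'a \<Rightarrow> bool" where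
  "admissible u l h w = (\<lambda>(d, p, q, g, m).
     u * (norm d)\<^sup>2 \<le> h \<bullet> d \<and> norm h \<le> l * norm d \<and>
     g \<bullet> (d + D w + A p) = w \<bullet> (d + D w + A p) \<and> norm g \<le> norm w)"

definition weight :: "'a \<times> 'b \<times> 'a \<times> 'a \<times> 'a \<Rightarrow> 'a \<times> 'b \<times> 'a \<times> 'a \<times> 'a" where
  "weight = (\<lambda>(d, p, q, g, m). (Wd d, Wp p, Wq q, Wg g, Wm m))"

text \<open>
  As a quadratic form, this is the sum of three cross terms
  \<open>- Wd d \<bullet> m + \<eta> * (Wm m \<bullet> S q) + Wg g \<bullet> A p\<close>. Along the flow, each of them is driven by the
  second of its factors: \<open>Wd d'\<close> contains \<open>m\<close>, \<open>Wm m'\<close> contains \<open>- S q\<close> and \<open>Wg g'\<close> contains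
  \<open>- A p\<close>.
\<close>

definition coupling :: "real \<Rightarrow> 'a \<times> 'b \<times> 'a \<times> 'a \<times> 'a \<Rightarrow> 'a \<times> 'b \<times> 'a \<times> 'a \<times> 'a" where
  "coupling \<eta> = (\<lambda>(d, p, q, g, m). (0, At (Wg g), \<eta> *\<^sub>R S (Wm m), 0, - Wd d))"

definition damped :: "'a \<Rightarrow> 'a \<times> 'b \<times> 'a \<times> 'a \<times> 'a \<Rightarrow> real" where
  "damped w = (\<lambda>(d, p, q, g, m). (norm d)\<^sup>2 + (norm w)\<^sup>2)"

definition undamped :: "'a \<times> 'b \<times> 'a \<times> 'a \<times> 'a \<Rightarrow> real" where
  "undamped = (\<lambda>(d, p, q, g, m). (norm m)\<^sup>2 + (norm (S q))\<^sup>2 + (norm (A p))\<^sup>2)"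

text \<open>
  The energy contains \<open>p\<close> and \<open>q\<close>, while only \<open>A p\<close> and \<open>S q\<close> are seen by the dynamics.
\<close>

definition observable :: "real \<Rightarrow> 'a \<times> 'b \<times> 'a \<times> 'a \<times> 'a \<Rightarrow> bool" where
  "observable c = (\<lambda>(d, p, q, g, m). norm p \<le> c * norm (A p) \<and> norm q \<le> c * norm (S q))"

lemmas pdD = pd[THEN pos_def_inverse_pairD(1)] pd[THEN pos_def_inverse_pairD(2)]
lemmas W_X = pd[THEN pos_def_inverse_pairD(3)]
lemmas W_sym = pd[THEN pos_def_inverse_pairD(4)]
lemmas W_pos = pd[THEN pos_def_inverse_pairD(5)]

lemmas linear_pieces = pdD lin
lemmas lin_simps = linear_pieces[THEN linear_add] linear_pieces[THEN linear_cmul]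
  linear_pieces[THEN linear_neg] linear_pieces[THEN linear_diff]

lemma linear_weight: "linear weight"
  by (rule linearI) (auto simp: weight_def lin_simps split: prod.splits)

lemma linear_coupling: "linear (coupling \<eta>)"
  by (rule linearI) (auto simp: coupling_def lin_simps algebra_simps split: prod.splits)

lemma weight_symmetric: "x \<bullet> weight y = weight x \<bullet> y"
  by (cases x; cases y) (simp add: weight_def inner_prod_def W_sym)

lemma weight_pos: "x \<noteq> 0 \<Longrightarrow> 0 < x \<bullet> weight x"
proof -
  assume x: "x \<noteq> 0"
  obtain d p q g m where [simp]: "x = (d, p, q, g, m)" by (cases x)
  have nn: "0 \<le> d \<bullet> Wd d" "0 \<le> p \<bullet> Wp p" "0 \<le> q \<bullet> Wq q" "0 \<le> g \<bullet> Wg g" "0 \<le> m \<bullet> Wm m"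
    using W_pos by (metis inner_zero_left less_eq_real_def)+
  from x consider "d \<noteq> 0" | "p \<noteq> 0" | "q \<noteq> 0" | "g \<noteq> 0" | "m \<noteq> 0" by (auto simp: zero_prod_def)
  then show ?thesis
    using nn W_pos by cases (force simp: weight_def)+
qed

text \<open>
  The saddle structure makes all couplings between the variables cancel; what is left is the
  convexity of the cost and the damping of all buses, the load buses included, since there the
  balance equation replaces the missing equation of motion.
\<close>

lemma energy_rate:
  assumes "admissible u l h w z"
  shows "z \<bullet> weight (field h w z) \<le> - min u \<delta> * damped w z"
proof -
  obtain d p q g m where [simp]: "z = (d, p, q, g, m)" by (cases z)
  define v where "v = d + D w + A p"
  from assms have h: "u * (norm d)\<^sup>2 \<le> h \<bullet> d" and v: "g \<bullet> v = w \<bullet> v"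
    by (auto simp: admissible_def v_def)
  have "z \<bullet> weight (field h w z) =
      d \<bullet> (- h + w + m) + p \<bullet> At w + q \<bullet> S m - g \<bullet> v - m \<bullet> (d + S q)"
    by (simp add: weight_def field_def W_X lin_simps v_def algebra_simps)
  also have "\<dots> = - (h \<bullet> d) - w \<bullet> D w"
    unfolding v using adj[of p w] S_sym[of q m]
    by (simp add: v_def inner_add_left inner_add_right inner_diff_right inner_commute)
  also have "\<dots> \<le> - (u * (norm d)\<^sup>2) - \<delta> * (norm w)\<^sup>2" using h \<delta>(2)[of w] by simp
  also have "\<dots> \<le> - min u \<delta> * damped w z"
  proof -
    have "min u \<delta> * (norm d)\<^sup>2 \<le> u * (norm d)\<^sup>2" "min u \<delta> * (norm w)\<^sup>2 \<le> \<delta> * (norm w)\<^sup>2"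
      by (intro mult_right_mono; simp)+
    then show ?thesis by (simp add: damped_def algebra_simps)
  qed
  finally show ?thesis .
qed

text \<open>
  Each cross term produces minus the square of one undamped quantity, and errors. Errors that
  involve a damped quantity are absorbed by Young's inequality. The only other error is the
  \<open>m\<close>-part of the derivative of \<open>\<eta> * (Wm m \<bullet> S q)\<close>, which is quadratic in \<open>m\<close>; taking \<open>\<eta>\<close>
  small subordinates it to the decrease that comes from \<open>- Wd d \<bullet> m\<close>.
\<close>

lemma coupling_rate:
  obtains \<kappa> K \<eta> where "\<kappa> > 0" "K \<ge> 0"
    "\<And>h w z. admissible u l h w z \<Longrightarrow>
       field h w z \<bullet> coupling \<eta> z + z \<bullet> coupling \<eta> (field h w z) \<le> K * damped w z - \<kappa> * undamped z"
proof -
  obtain K1 where K1: "K1 > 0" "\<And>x. norm (A (Xp (At x))) \<le> K1 * norm x"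
    using linear_bounded_pos[OF linear_compose[OF lin(2) linear_compose[OF pdD(2) lin(1)]]]
    by (auto simp: o_def)
  obtain G where G: "G > 0" "\<And>x. norm (Wg x) \<le> G * norm x"
    using linear_bounded_pos[OF pdD(9)] by blast
  obtain K2 where K2: "K2 > 0" "\<And>x. \<bar>S (Xq (S x)) \<bullet> Wm x\<bar> \<le> K2 * (norm x)\<^sup>2"
  proof -
    obtain a where a: "a > 0" "\<And>x. norm (S (Xq (S x))) \<le> a * norm x"
      using linear_bounded_pos[OF linear_compose[OF lin(3) linear_compose[OF pdD(3) lin(3)]]]
      by (auto simp: o_def)
    obtain b where b: "b > 0" "\<And>x. norm (Wm x) \<le> b * norm x"
      using linear_bounded_pos[OF pdD(10)] by blast
    have "\<bar>S (Xq (S x)) \<bullet> Wm x\<bar> \<le> a * b * (norm x)\<^sup>2" for x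
    proof -
      have "\<bar>S (Xq (S x)) \<bullet> Wm x\<bar> \<le> norm (S (Xq (S x))) * norm (Wm x)" by (rule Cauchy_Schwarz_ineq2)
      also have "\<dots> \<le> (a * norm x) * (b * norm x)" using a b by (intro mult_mono) auto
      finally show ?thesis by (simp add: power2_eq_square algebra_simps)
    qed
    then show thesis using that[of "a * b"] a b by simp
  qed
  obtain Km where Km: "Km > 0" "\<And>x. norm (Xm x) \<le> Km * norm x"
    using linear_bounded_pos[OF pdD(5)] by blast
  obtain Kd where Kd: "Kd > 0" "\<And>x. norm (Wd x) \<le> Kd * norm x"
    using linear_bounded_pos[OF pdD(6)] by blast
  obtain K4 where K4: "K4 > 0" "\<And>x. norm (D x) \<le> K4 * norm x"
    using linear_bounded_pos[OF lin(4)] by blast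
  define K3 where "K3 = Km * Kd"
  define \<eta> where "\<eta> = 1 / (4 * (K2 + 1))"
  have eta: "\<eta> > 0" "\<eta> \<le> 1 / 4" "\<eta> * K2 \<le> 1 / 4" using K2 by (auto simp: \<eta>_def field_simps)
  define K where "K = K1 * G + K3 + K3\<^sup>2 / \<eta> + \<eta> + 1 + K4\<^sup>2 + 2 * l\<^sup>2 + 2"
  have K3: "K3 > 0" using Km Kd by (simp add: K3_def)
  have K0: "K \<ge> 0" using K1 G K3 eta by (simp add: K_def)
  have "field h w z \<bullet> coupling \<eta> z + z \<bullet> coupling \<eta> (field h w z) \<le> K * damped w z - \<eta> / 2 * undamped z"
    if adm: "admissible u l h w z" for h w z
  proof -
    obtain d p q g m where [simp]: "z = (d, p, q, g, m)" by (cases z)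
    define v where "v = d + D w + A p"
    from adm have h: "norm h \<le> l * norm d" and g: "norm g \<le> norm w"
      by (auto simp: admissible_def)
    let ?a = "norm d" and ?b = "norm w" and ?m = "norm m" and ?s = "norm (S q)" and ?y = "norm (A p)"
    have expand: "field h w z \<bullet> coupling \<eta> z + z \<bullet> coupling \<eta> (field h w z) =
       A (Xp (At w)) \<bullet> Wg g + \<eta> * (S (Xq (S m)) \<bullet> Wm m) + Xm (d + S q) \<bullet> Wd d
       - A p \<bullet> v - \<eta> * (S q \<bullet> (d + S q)) - m \<bullet> (- h + w + m)"
    proof -
      have "Xp (At w) \<bullet> At (Wg g) = A (Xp (At w)) \<bullet> Wg g" "p \<bullet> At v = A p \<bullet> v"
        "Xq (S m) \<bullet> S (Wm m) = S (Xq (S m)) \<bullet> Wm m" "q \<bullet> S (- d - S q) = - (S q \<bullet> (d + S q))"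
        using S_sym[of q "- d - S q"] by (simp_all add: adj S_sym inner_add_right inner_diff_right)
      then show ?thesis
        by (simp add: inner_add_right inner_diff_right distrib_left right_diff_distrib
            coupling_def field_def W_X linear_neg[OF pdD(9)] linear_neg[OF pdD(10)]
            linear_neg[OF lin(2)] linear_neg[OF lin(3)] flip: v_def)
    qed
    have t1: "A (Xp (At w)) \<bullet> Wg g \<le> K1 * G * ?b\<^sup>2"
    proof -
      have "A (Xp (At w)) \<bullet> Wg g \<le> norm (A (Xp (At w))) * norm (Wg g)" by (rule norm_cauchy_schwarz)
      also have "\<dots> \<le> (K1 * ?b) * (G * ?b)"
        using K1 G order_trans[OF G(2) mult_left_mono[OF g]] by (intro mult_mono) auto
      finally show ?thesis by (simp add: power2_eq_square algebra_simps)
    qed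
    have t2: "\<eta> * (S (Xq (S m)) \<bullet> Wm m) \<le> ?m\<^sup>2 / 4"
    proof -
      have "\<eta> * (S (Xq (S m)) \<bullet> Wm m) \<le> \<eta> * (K2 * ?m\<^sup>2)"
        using K2(2)[of m] eta by (intro mult_left_mono) auto
      also have "\<dots> = (\<eta> * K2) * ?m\<^sup>2" by simp
      also have "\<dots> \<le> 1 / 4 * ?m\<^sup>2" by (intro mult_right_mono eta) auto
      finally show ?thesis by simp
    qed
    have t3: "Xm (d + S q) \<bullet> Wd d \<le> K3 * ?a\<^sup>2 + (\<eta> / 4 * ?s\<^sup>2 + K3\<^sup>2 / \<eta> * ?a\<^sup>2)"
    proof -
      have "Xm (d + S q) \<bullet> Wd d \<le> norm (Xm (d + S q)) * norm (Wd d)" by (rule norm_cauchy_schwarz)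
      also have "\<dots> \<le> (Km * (?a + ?s)) * (Kd * ?a)"
        using Km Kd order_trans[OF Km(2) mult_left_mono[OF norm_triangle_ineq]]
        by (intro mult_mono) auto
      also have "\<dots> = K3 * ?a\<^sup>2 + ?s * (K3 * ?a)"
        by (simp add: K3_def power2_eq_square algebra_simps)
      also have "?s * (K3 * ?a) \<le> \<eta> / 4 * ?s\<^sup>2 + K3\<^sup>2 / \<eta> * ?a\<^sup>2"
        using young_inequality[of "\<eta> / 4" ?s "K3 * ?a"] eta by (simp add: power_mult_distrib)
      finally show ?thesis by simp
    qed
    have t4: "- (A p \<bullet> v) \<le> - (?y\<^sup>2 / 2) + ?a\<^sup>2 + K4\<^sup>2 * ?b\<^sup>2"
    proof -
      have "- (A p \<bullet> v) = - ?y\<^sup>2 + A p \<bullet> - (d + D w)"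
        by (simp add: v_def inner_right_distrib inner_diff_right power2_norm_eq_inner algebra_simps)
      also have "A p \<bullet> - (d + D w) \<le> ?y * norm (d + D w)"
        using norm_cauchy_schwarz[of "A p" "- (d + D w)"] by (simp only: norm_minus_cancel)
      also have "\<dots> \<le> ?y * (?a + K4 * ?b)"
        using K4(2)[of w] norm_triangle_ineq[of d "D w"] by (intro mult_left_mono) auto
      also have "\<dots> \<le> ?y\<^sup>2 / 2 + (?a + K4 * ?b)\<^sup>2 / 2"
        using young_inequality[of "1 / 2" ?y "?a + K4 * ?b"] by simp
      also have "(?a + K4 * ?b)\<^sup>2 \<le> 2 * ?a\<^sup>2 + 2 * (K4\<^sup>2 * ?b\<^sup>2)"
        using sum_squares_bound[of ?a "K4 * ?b"] by (simp add: power2_sum power_mult_distrib)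
      finally show ?thesis by (simp add: add_divide_distrib)
    qed
    have t5: "- (\<eta> * (S q \<bullet> (d + S q))) \<le> - (\<eta> * ?s\<^sup>2) + (\<eta> / 4 * ?s\<^sup>2 + \<eta> * ?a\<^sup>2)"
    proof -
      have "- (S q \<bullet> d) \<le> ?s * ?a"
        using Cauchy_Schwarz_ineq2[of "S q" d] by linarith
      also have "\<dots> \<le> ?s\<^sup>2 / 4 + ?a\<^sup>2" using young_inequality[of "1 / 4" ?s ?a] by simp
      finally have "\<eta> * - (S q \<bullet> d) \<le> \<eta> * (?s\<^sup>2 / 4 + ?a\<^sup>2)" using eta by (intro mult_left_mono) auto
      then show ?thesis by (simp add: inner_right_distrib power2_norm_eq_inner algebra_simps)
    qed
    have t6: "- (m \<bullet> (- h + w + m)) \<le> - ?m\<^sup>2 + (?m\<^sup>2 / 4 + (2 * l\<^sup>2 * ?a\<^sup>2 + 2 * ?b\<^sup>2))"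
    proof -
      have "- (m \<bullet> (- h + w + m)) = - ?m\<^sup>2 + m \<bullet> (h - w)"
        by (simp add: power2_norm_eq_inner algebra_simps)
      also have "m \<bullet> (h - w) \<le> ?m * norm (h - w)" by (rule norm_cauchy_schwarz)
      also have "\<dots> \<le> ?m * (l * ?a + ?b)"
        using h norm_triangle_ineq4[of h w] by (intro mult_left_mono) auto
      also have "\<dots> \<le> ?m\<^sup>2 / 4 + (l * ?a + ?b)\<^sup>2"
        using young_inequality[of "1 / 4" ?m "l * ?a + ?b"] by simp
      also have "(l * ?a + ?b)\<^sup>2 \<le> 2 * l\<^sup>2 * ?a\<^sup>2 + 2 * ?b\<^sup>2"
        using sum_squares_bound[of "l * ?a" ?b] by (simp add: power2_sum power_mult_distrib)
      finally show ?thesis by simp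
    qed
    have K_split: "(K1 * G + K4\<^sup>2 + 2) * ?b\<^sup>2 \<le> K * ?b\<^sup>2"
        "(K3 + K3\<^sup>2 / \<eta> + 1 + \<eta> + 2 * l\<^sup>2) * ?a\<^sup>2 \<le> K * ?a\<^sup>2"
      using K1 G K3 eta by (intro mult_right_mono; simp add: K_def)+
    have eta_m: "\<eta> / 2 * ?m\<^sup>2 \<le> 1 / 2 * ?m\<^sup>2" "\<eta> / 2 * ?y\<^sup>2 \<le> 1 / 2 * ?y\<^sup>2"
      using eta by (intro mult_right_mono; simp)+
    from t1 t2 t3 t4 t5 t6 K_split eta_m show ?thesis
      unfolding expand by (simp add: damped_def undamped_def algebra_simps)
  qed
  then show thesis using that[of "\<eta> / 2" K \<eta>] eta K0 by simp
qed

text \<open>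
  The load frequencies are not part of the state. Testing the balance equation with \<open>w\<close>, and
  using that the damping is positive, recovers them from the state.
\<close>

lemma frequency_bounded_by_state:
  obtains C where "C \<ge> 0"
    "\<And>u l h w z. admissible u l h w z \<Longrightarrow> norm w \<le> C * norm z"
proof -
  obtain KA where KA: "KA > 0" "\<And>x. norm (A x) \<le> KA * norm x"
    using linear_bounded_pos[OF lin(1)] by blast
  obtain KD where KD: "KD > 0" "\<And>x. norm (D x) \<le> KD * norm x"
    using linear_bounded_pos[OF lin(4)] by blast
  define C where "C = (2 * (1 + KA) + KD) / \<delta>"
  have C: "C \<ge> 0" using KA KD \<delta>(1) by (simp add: C_def)
  have "norm w \<le> C * norm z" if adm: "admissible u l h w z" for u l h w z
  proof -
    obtain d p q g m where z: "z = (d, p, q, g, m)" by (cases z)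
    let ?Z = "norm z" and ?w = "norm w"
    from adm have v: "g \<bullet> (d + D w + A p) = w \<bullet> (d + D w + A p)" and gw: "norm g \<le> ?w"
      by (auto simp: admissible_def z)
    have le: "norm d \<le> ?Z" "norm p \<le> ?Z" "norm g \<le> ?Z"
      unfolding z by (meson norm_fst_le norm_snd_le order_trans)+
    have dA: "norm (d + A p) \<le> (1 + KA) * ?Z"
    proof -
      have "KA * norm p \<le> KA * ?Z" using le(2) KA(1) by simp
      then show ?thesis
        using norm_triangle_ineq[of d "A p"] le(1) KA(2)[of p] by (simp add: distrib_right)
    qed
    have "\<delta> * ?w\<^sup>2 \<le> w \<bullet> D w" by (rule \<delta>)
    also have "\<dots> = (g - w) \<bullet> (d + A p) + g \<bullet> D w"
      using v by (simp add: algebra_simps)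
    also have "\<dots> \<le> (2 * ?w) * ((1 + KA) * ?Z) + ?Z * (KD * ?w)"
    proof (rule add_mono)
      have "(g - w) \<bullet> (d + A p) \<le> norm (g - w) * norm (d + A p)" by (rule norm_cauchy_schwarz)
      also have "\<dots> \<le> (2 * ?w) * ((1 + KA) * ?Z)"
        using norm_triangle_ineq4[of g w] gw dA by (intro mult_mono) auto
      finally show "(g - w) \<bullet> (d + A p) \<le> (2 * ?w) * ((1 + KA) * ?Z)" .
      have "g \<bullet> D w \<le> norm g * norm (D w)" by (rule norm_cauchy_schwarz)
      also have "\<dots> \<le> ?Z * (KD * ?w)" using le KD by (intro mult_mono) auto
      finally show "g \<bullet> D w \<le> ?Z * (KD * ?w)" .
    qed
    finally have "?w * (\<delta> * ?w) \<le> ?w * ((2 * (1 + KA) + KD) * ?Z)"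
      by (simp add: power2_eq_square algebra_simps)
    then show ?thesis
    proof (cases "w = 0")
      case False
      with \<open>?w * (\<delta> * ?w) \<le> _\<close> have "\<delta> * ?w \<le> (2 * (1 + KA) + KD) * ?Z" by simp
      then show ?thesis using \<delta>(1) by (simp add: C_def field_simps)
    qed (use C in simp)
  qed
  with C that show thesis by blast
qed

text \<open>
  For an observable state the damped and the undamped quantities together control the squared
  norm, so the previous rates combine to a strictified energy.
\<close>

lemma exponential_decay:
  assumes "u > 0"
  shows "\<exists>\<rho>>0. \<exists>C\<ge>0. \<forall>h w z.
    (\<forall>t\<ge>0. (z has_vector_derivative field (h t) (w t) (z t)) (at t within {0..}) \<and>
       admissible u l (h t) (w t) (z t) \<and> observable c (z t))
    \<longrightarrow> (\<forall>t\<ge>0. norm (z t) + 2 * norm (w t) \<le> C * norm (z 0) * exp (- \<rho> * t))"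
proof -
  obtain \<kappa> K \<eta> where k: "\<kappa> > 0" "K \<ge> 0"
    and rate: "\<And>h w z. admissible u l h w z \<Longrightarrow>
       field h w z \<bullet> coupling \<eta> z + z \<bullet> coupling \<eta> (field h w z) \<le> K * damped w z - \<kappa> * undamped z"
    using that by (rule coupling_rate[of u l])
  obtain E where E: "E \<ge> 0" "\<And>u l h w z. admissible u l h w z \<Longrightarrow> norm w \<le> E * norm z"
    using that by (rule frequency_bounded_by_state)
  have min: "min u \<delta> > 0" using assms \<delta>(1) by simp
  have M: "1 + c\<^sup>2 \<ge> 0" by simp
  have size: "(norm z)\<^sup>2 \<le> (1 + c\<^sup>2) * (damped w z + undamped z)"
    if "admissible u l h w z" "observable c z" for h w z
  proof -
    obtain d p q g m where z: "z = (d, p, q, g, m)" by (cases z)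
    from that have "norm g \<le> norm w" "norm p \<le> c * norm (A p)" "norm q \<le> c * norm (S q)"
      by (auto simp: admissible_def observable_def z)
    from this[THEN power_mono, of 2]
    have sq: "(norm g)\<^sup>2 \<le> (norm w)\<^sup>2" "(norm p)\<^sup>2 \<le> c\<^sup>2 * (norm (A p))\<^sup>2"
        "(norm q)\<^sup>2 \<le> c\<^sup>2 * (norm (S q))\<^sup>2"
      by (simp_all add: power_mult_distrib)
    have "0 \<le> c\<^sup>2 * (norm d)\<^sup>2" "0 \<le> c\<^sup>2 * (norm w)\<^sup>2" "0 \<le> c\<^sup>2 * (norm m)\<^sup>2"
        "0 \<le> (norm (A p))\<^sup>2" "0 \<le> (norm (S q))\<^sup>2"
      by simp_all
    moreover have "(norm z)\<^sup>2 = (norm d)\<^sup>2 + (norm p)\<^sup>2 + (norm q)\<^sup>2 + (norm g)\<^sup>2 + (norm m)\<^sup>2"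
      by (simp add: z norm_Pair)
    ultimately show ?thesis
      unfolding z damped_def undamped_def prod.case distrib_left distrib_right mult_1
      using sq by linarith
  qed
  obtain \<rho> C where \<rho>: "\<rho> > 0" "C \<ge> 0"
    and decay: "\<forall>z z' r q.
    (\<forall>t\<ge>0. (z has_vector_derivative z' t) (at t within {0..}) \<and> 0 \<le> r t \<and> 0 \<le> q t \<and>
       z t \<bullet> weight (z' t) \<le> - min u \<delta> * r t \<and>
       z' t \<bullet> coupling \<eta> (z t) + z t \<bullet> coupling \<eta> (z' t) \<le> K * r t - \<kappa> * q t \<and>
       (norm (z t))\<^sup>2 \<le> (1 + c\<^sup>2) * (r t + q t))
    \<longrightarrow> (\<forall>t\<ge>0. norm (z t) \<le> C * norm (z 0) * exp (- \<rho> * t))"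
    using exp_stability_by_strictified_energy[OF linear_weight weight_symmetric _
        linear_coupling[of \<eta>] min k M] weight_pos by metis
  have "norm (z t) + 2 * norm (w t) \<le> ((1 + 2 * E) * C) * norm (z 0) * exp (- \<rho> * t)"
    if hyp: "\<forall>t\<ge>0. (z has_vector_derivative field (h t) (w t) (z t)) (at t within {0..}) \<and>
        admissible u l (h t) (w t) (z t) \<and> observable c (z t)" and t: "t \<ge> 0" for h w z t
  proof -
    have der: "(z has_vector_derivative field (h s) (w s) (z s)) (at s within {0..})"
      and adm: "admissible u l (h s) (w s) (z s)" and obs: "observable c (z s)" if "s \<ge> 0" for s
      using hyp that by blast+
    have "norm (z t) \<le> C * norm (z 0) * exp (- \<rho> * t)"
    proof (rule decay[rule_format, where z = z and z' = "\<lambda>t. field (h t) (w t) (z t)"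
          and r = "\<lambda>t. damped (w t) (z t)" and q = "\<lambda>t. undamped (z t)", OF _ t], intro conjI)
      fix t :: real assume "t \<ge> 0"
      note at = adm[OF this] obs[OF this]
      show "(z has_vector_derivative field (h t) (w t) (z t)) (at t within {0..})"
        by (rule der[OF \<open>t \<ge> 0\<close>])
      show "0 \<le> damped (w t) (z t)" "0 \<le> undamped (z t)"
        by (simp_all add: damped_def undamped_def split: prod.splits)
    qed (blast intro: energy_rate rate size adm obs)+
    then have "(1 + 2 * E) * norm (z t) \<le> (1 + 2 * E) * (C * norm (z 0) * exp (- \<rho> * t))"
      using E(1) by (intro mult_left_mono) auto
    with E(2)[OF adm[OF t]] show ?thesis by (simp add: algebra_simps)
  qed
  moreover have "0 \<le> (1 + 2 * E) * C" using \<rho> E(1) by simp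
  ultimately show ?thesis using \<rho>(1) by blast
qed

end

section \<open>Network matrices and cost gradients\<close>

lemma pos_def_inverse_pair_componentwise:
  fixes a :: "'i::finite \<Rightarrow> real"
  assumes a: "\<And>i. a i > 0"
  shows "pos_def_inverse_pair (\<lambda>v. \<chi> i. a i * v $ i) (\<lambda>v. \<chi> i. v $ i / a i)"
  unfolding pos_def_inverse_pair_def
proof (intro conjI allI impI)
  show "linear (\<lambda>v. \<chi> i. a i * v $ i)" "linear (\<lambda>v. \<chi> i. v $ i / a i)"
    by (auto intro!: linearI simp: vec_eq_iff algebra_simps add_divide_distrib)
  show "(\<chi> i. (\<chi> i. a i * x $ i) $ i / a i) = x" for x :: "real ^ 'i"
    using a by (simp add: vec_eq_iff less_imp_neq[symmetric])
  show "x \<bullet> (\<chi> i. y $ i / a i) = (\<chi> i. x $ i / a i) \<bullet> y" for x y :: "real ^ 'i"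
    by (simp add: inner_vec_def)
  show "0 < x \<bullet> (\<chi> i. x $ i / a i)" if "x \<noteq> 0" for x :: "real ^ 'i"
  proof -
    from that obtain i where "x $ i \<noteq> 0" by (auto simp: vec_eq_iff)
    then have "0 < x $ i * (x $ i / a i)" using a[of i] by (simp add: zero_less_divide_iff flip: power2_eq_square)
    moreover have "0 \<le> x $ j * (x $ j / a j)" for j using a[of j] by simp
    ultimately show ?thesis unfolding inner_vec_def by (auto intro!: sum_pos2[of _ i])
  qed
qed

text \<open>
  Outside \<open>I\<close> the diagonal of \<open>X\<close> is arbitrary and is replaced by ones.
\<close>

lemma pos_def_diagonal_onE:
  fixes X :: "real ^ 'i ^ 'i::finite"
  assumes X: "pos_def_diagonal_on I X"
  obtains X' W where "pos_def_inverse_pair X' W" "\<And>v. v \<in> coord_space I \<Longrightarrow> X *v v = X' v"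
    "\<And>v. v \<in> coord_space I \<Longrightarrow> X' v \<in> coord_space I"
proof -
  define a where "a = (\<lambda>i. if i \<in> I then X $ i $ i else 1)"
  have off: "X $ i $ j = 0" if "i \<noteq> j" for i j
    using X that by (simp add: pos_def_diagonal_on_def)
  have mult: "(X *v v) $ i = X $ i $ i * v $ i" for v i
  proof -
    have "(X *v v) $ i = (\<Sum>j\<in>UNIV. if j = i then X $ i $ i * v $ i else 0)"
      unfolding matrix_vector_mult_def vec_lambda_beta
      by (rule sum.cong) (auto simp: off)
    then show ?thesis by simp
  qed
  have "a i > 0" for i
  proof (cases "i \<in> I")
    case True
    have "axis i (1::real) \<in> coord_space I" "axis i (1::real) \<noteq> 0"
      using True by (auto simp: coord_space_def axis_def vec_eq_iff)
    then have "0 < axis i 1 \<bullet> (X *v axis i 1)" using X unfolding pos_def_diagonal_on_def by blast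
    also have "\<dots> = X $ i $ i" by (simp add: inner_axis' mult)
    finally show ?thesis using True by (simp add: a_def)
  qed (simp add: a_def)
  from pos_def_inverse_pair_componentwise[of a, OF this] show thesis
    by (rule that) (auto simp: coord_space_def vec_eq_iff mult a_def)
qed

lemma derivative_bounds_imp_slope:
  fixes f :: "real \<Rightarrow> real"
  assumes "\<And>s. f differentiable (at s)" and "\<And>s. u \<le> deriv f s \<and> deriv f s \<le> l"
  obtains k where "u \<le> k" "k \<le> l" "f a - f b = k * (a - b)"
proof -
  have D: "(f has_real_derivative deriv f s) (at s)" for s
    using assms(1)[of s] by (simp add: DERIV_deriv_iff_real_differentiable)
  consider "a = b" | "a < b" | "b < a" by linarith
  then show thesis
  proof cases
    case 1
    then show thesis using that[of "deriv f a"] assms(2) by simp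
  next
    case 2
    from MVT2[OF 2, of f "deriv f"] D obtain s where "f b - f a = (b - a) * deriv f s" by blast
    then show thesis using that[of "deriv f s"] assms(2) by (simp add: algebra_simps)
  next
    case 3
    from MVT2[OF 3, of f "deriv f"] D obtain s where "f a - f b = (a - b) * deriv f s" by blast
    then show thesis using that[of "deriv f s"] assms(2) by (simp add: algebra_simps)
  qed
qed

text \<open>
  Since the cost is separable, the mean value theorem applies in each coordinate.
\<close>

lemma grad_cost_monotone_lipschitz:
  fixes N :: "'n::finite alc"
  assumes "0 < u" and diff: "\<And>i s. deriv (cost N i) differentiable (at s)"
    and bounds: "\<And>i s. u \<le> deriv (deriv (cost N i)) s \<and> deriv (deriv (cost N i)) s \<le> l"
  shows "u * (norm (x - y))\<^sup>2 \<le> (grad_cost N x - grad_cost N y) \<bullet> (x - y)" (is ?mono)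
    and "norm (grad_cost N x - grad_cost N y) \<le> l * norm (x - y)" (is ?lip)
proof -
  have "\<exists>k. u \<le> k \<and> k \<le> l \<and> deriv (cost N i) (x $ i) - deriv (cost N i) (y $ i) = k * (x $ i - y $ i)" for i
    using derivative_bounds_imp_slope[OF diff bounds] by metis
  then obtain k where k: "\<And>i. u \<le> k i" "\<And>i. k i \<le> l"
    "\<And>i. deriv (cost N i) (x $ i) - deriv (cost N i) (y $ i) = k i * (x $ i - y $ i)" by metis
  have h: "(grad_cost N x - grad_cost N y) $ i = k i * (x - y) $ i" for i
    by (simp add: grad_cost_def k(3))
  show ?mono
    unfolding power2_norm_eq_inner inner_vec_def sum_distrib_left
    using k(1) by (intro sum_mono) (simp del: vector_minus_component add: h mult.assoc mult_right_mono)
  have l: "l \<ge> 0" using k[of undefined] \<open>0 < u\<close> by linarith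
  have "norm (grad_cost N x - grad_cost N y) \<le> norm (l *\<^sub>R (x - y))"
  proof (rule norm_le_componentwise_cart)
    fix i
    have "\<bar>k i\<bar> \<le> \<bar>l\<bar>" using k(1)[of i] k(2)[of i] \<open>0 < u\<close> by linarith
    then show "norm ((grad_cost N x - grad_cost N y) $ i) \<le> norm ((l *\<^sub>R (x - y)) $ i)"
      unfolding h by (simp add: abs_mult mult_right_mono)
  qed
  then show ?lip using l by simp
qed

lemma inner_matrix_transpose: "(M *v p) \<bullet> x = p \<bullet> (transpose M *v x)"
  for M :: "real ^ 'm::finite ^ 'n::finite"
  by (metis dot_lmul_matrix inner_commute transpose_matrix_vector)

lemma transpose_mat_S: "transpose (mat_S N) = mat_S N"
proof -
  have "transpose (diag v) = diag v" for v :: "real ^ 'i::finite"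
    by (auto simp: diag_def transpose_def vec_eq_iff)
  from this[of "line_susc N"] show ?thesis by (simp add: mat_S_def matrix_transpose_mul matrix_mul_assoc)
qed

lemma transpose_mat_A_in_coord_space: "transpose (mat_A N) *v w \<in> coord_space (lines N)"
  by (auto simp: coord_space_def matrix_vector_mult_def transpose_def mat_A_def incidence_def)

lemma mat_D_component: "(mat_D N *v x) $ i = damping N $ i * x $ i"
proof -
  have "(mat_D N *v x) $ i = (\<Sum>j\<in>UNIV. if j = i then damping N $ i * x $ i else 0)"
    unfolding matrix_vector_mult_def vec_lambda_beta
    by (rule sum.cong) (auto simp: mat_D_def diag_def)
  then show ?thesis by simp
qed

lemma mat_D_coercive:
  fixes N :: "'n::finite alc"
  assumes "\<And>i. 0 < damping N $ i"
  obtains \<delta> where "\<delta> > 0" "\<And>x. \<delta> * (norm x)\<^sup>2 \<le> x \<bullet> (mat_D N *v x)"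
proof (rule positive_definite_coercive)
  show "linear ((*v) (mat_D N))" by simp
  show "0 < x \<bullet> (mat_D N *v x)" if "x \<noteq> 0" for x
  proof -
    from that obtain i where "x $ i \<noteq> 0" by (auto simp: vec_eq_iff)
    then have "0 < x $ i * (damping N $ i * x $ i)" using assms[of i]
      by (auto simp: zero_less_mult_iff mult_less_0_iff linorder_neq_iff)
    moreover have "0 \<le> x $ j * (damping N $ j * x $ j)" for j
      using mult_nonneg_nonneg[OF less_imp_le[OF assms[of j]] zero_le_square[of "x $ j"]]
      by (simp add: mult.left_commute)
    ultimately show ?thesis unfolding inner_vec_def by (auto intro!: sum_pos2[of _ i] simp: mat_D_component)
  qed
qed blast

lemma restr_orthogonal_projection:
  "linear (restr I)" "norm (restr I v) \<le> norm v" "restr I v \<in> coord_space I"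
  "restr I v \<bullet> x = v \<bullet> restr I x"
proof -
  show "linear (restr I)" by (rule linearI) (auto simp: restr_def vec_eq_iff)
  show "norm (restr I v) \<le> norm v" by (rule norm_le_componentwise_cart) (simp add: restr_def)
  show "restr I v \<in> coord_space I" by (simp add: restr_def coord_space_def)
  show "restr I v \<bullet> x = v \<bullet> restr I x" by (auto simp: inner_vec_def restr_def intro!: sum.cong)
qed

text \<open>
  The form in which the balance equation is used: the power residual has no load component.
\<close>

lemma restr_gens_eq:
  assumes "gens N \<union> loads N = UNIV" "0 = restr (loads N) r"
  shows "restr (gens N) r = r"
proof -
  have "r $ i = 0" if "i \<in> loads N" for i
    using arg_cong[OF assms(2), of "\<lambda>v. v $ i"] that by (simp add: restr_def)
  then show ?thesis using assms(1) by (auto simp: restr_def vec_eq_iff)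
qed

section \<open>Convergence of the load control dynamics\<close>

theorem theorem2:
  fixes N :: "'n::finite alc" and u l :: real and xstar :: "'n state"
  assumes "alc_network N"
    and "reduced_olc_feasible N"
    and "0 < u" and "u \<le> l"
    and "\<And>i s. cost N i differentiable (at s)"
    and "\<And>i s. deriv (cost N i) differentiable (at s)"
    and "\<And>i s. u \<le> deriv (deriv (cost N i)) s \<and> deriv (deriv (cost N i)) s \<le> l"
    and "rd_equilibrium N xstar"
  shows "\<exists>\<rho>\<^sub>0>0. \<forall>x. rd_solution N x \<longrightarrow>
           (\<exists>C\<^sub>0\<ge>0. \<forall>t\<ge>0. infdist (x t) (equilibrium_set N xstar) \<le> C\<^sub>0 * exp (- \<rho>\<^sub>0 * t))"
proof -
  note net = assms(1)[unfolded alc_network_def]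
  have cover: "gens N \<union> loads N = UNIV" and damping: "\<And>i. 0 < damping N $ i" using net by auto
  have UNIV_space: "v \<in> coord_space UNIV" for v :: "real ^ 'n" by (simp add: coord_space_def)
  obtain Xd Wd where d: "pos_def_inverse_pair Xd Wd" "\<And>v. Xi_d N *v v = Xd v"
    using net UNIV_space by (metis pos_def_diagonal_onE)
  obtain Xp Wp where p: "pos_def_inverse_pair Xp Wp"
      "\<And>v. v \<in> coord_space (lines N) \<Longrightarrow> Xi_P N *v v = Xp v"
      "\<And>v. v \<in> coord_space (lines N) \<Longrightarrow> Xp v \<in> coord_space (lines N)"
    using net by (metis pos_def_diagonal_onE)
  obtain Xq Wq where q: "pos_def_inverse_pair Xq Wq" "\<And>v. Xi_psi N *v v = Xq v"
    using net UNIV_space by (metis pos_def_diagonal_onE)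
  obtain Xg Wg where g: "pos_def_inverse_pair Xg Wg"
      "\<And>v. v \<in> coord_space (gens N) \<Longrightarrow> Xi_omega N *v v = Xg v"
    using net by (metis pos_def_diagonal_onE)
  obtain Xm Wm where m: "pos_def_inverse_pair Xm Wm" "\<And>v. Xi_mu N *v v = Xm v"
    using net UNIV_space by (metis pos_def_diagonal_onE)
  obtain \<delta> where \<delta>: "\<delta> > 0" "\<And>x. \<delta> * (norm x)\<^sup>2 \<le> x \<bullet> (mat_D N *v x)"
    using mat_D_coercive[OF damping] by blast
  let ?A = "(*v) (mat_A N)" and ?At = "(*v) (transpose (mat_A N))"
    and ?S = "(*v) (mat_S N)" and ?D = "(*v) (mat_D N)"
  have S_sym: "?S x \<bullet> y = x \<bullet> ?S y" for x y
    by (metis inner_matrix_transpose transpose_mat_S)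
  interpret saddle_flow Xd Wd Xq Wq Xg Wg Xm Wm Xp Wp ?A ?At ?S ?D \<delta>
    by (rule saddle_flow.intro)
      (simp_all only: d(1) p(1) q(1) g(1) m(1) \<delta> inner_matrix_transpose transpose_mat_S matrix_vector_mul_linear)
  obtain Lp where Lp: "linear Lp" "\<And>y. Lp y \<in> range (\<lambda>w. Xp (?At w))"
    "\<And>w. Lp (?A (Xp (?At w))) = Xp (?At w)" "\<And>P. ?A (Lp (?A P)) = ?A P"
    using that by (rule weighted_partial_inverse[OF lin(1,2) adj p(1)])
  obtain Lq where Lq: "linear Lq" "\<And>y. Lq y \<in> range (\<lambda>w. Xq (?S w))"
    "\<And>w. Lq (?S (Xq (?S w))) = Xq (?S w)"
    "\<And>\<psi>. ?S (Lq (?S \<psi>)) = ?S \<psi>"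
    using that by (rule weighted_partial_inverse[OF lin(3,3) S_sym q(1)])
  obtain cp where cp: "cp > 0" "\<And>y. norm (Lp y) \<le> cp * norm y" using that
    by (rule linear_bounded_pos[OF Lp(1)])
  obtain cq where cq: "cq > 0" "\<And>y. norm (Lq y) \<le> cq * norm y" using that
    by (rule linear_bounded_pos[OF Lq(1)])
  \<comment> \<open>Discards the motionless parts of \<open>P\<close> and \<open>\<psi>\<close>.\<close>
  define reduce :: "'n state \<Rightarrow> 'n state" where
    "reduce = (\<lambda>(d, P, \<psi>, \<omega>, \<mu>). (d, Lp (?A P), Lq (?S \<psi>), \<omega>, \<mu>))"
  have lin_reduce: "linear reduce"
    by (rule linearI) (auto simp: reduce_def matrix_vector_right_distrib linear_add[OF Lp(1)] linear_add[OF Lq(1)]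
        linear_cmul[OF Lp(1)] linear_cmul[OF Lq(1)] matrix_vector_mult_scaleR)
  obtain d' P' \<psi>' \<omega>' \<mu>' where xstar: "xstar = (d', P', \<psi>', \<omega>', \<mu>')" by (cases xstar)
  define z where "z = (\<lambda>y. reduce (diff_part N y - diff_part N xstar))"
  define w :: "'n state \<Rightarrow> real ^ 'n" where "w = (\<lambda>(d, P, \<psi>, \<omega>, \<mu>). \<omega> - \<omega>')"
  define h :: "'n state \<Rightarrow> real ^ 'n" where "h = (\<lambda>(d, P, \<psi>, \<omega>, \<mu>). grad_cost N d - grad_cost N d')"
  have inj: "X v = 0 \<Longrightarrow> v = 0" if "pos_def_inverse_pair X W" for X W :: "'c::euclidean_space \<Rightarrow> 'c" and v
    using pos_def_inverse_pairD(2,3)[OF that] by (metis linear_0)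
  have residual: "Xi_omega N *v restr (gens N) (- d - ?D \<omega> - ?A P + injection N)
        = - Xg (d - injection N + ?D \<omega> + ?A P)"
      and residual_gens: "restr (gens N) (d - injection N + ?D \<omega> + ?A P) = d - injection N + ?D \<omega> + ?A P"
    if "rd_balance N (d, P, \<psi>, \<omega>, \<mu>)" for d P \<psi> \<omega> \<mu>
  proof -
    let ?r = "d - injection N + ?D \<omega> + ?A P"
    show r: "restr (gens N) ?r = ?r"
      using that by (intro restr_gens_eq[OF cover]) simp
    have "restr (gens N) (- d - ?D \<omega> - ?A P + injection N) = restr (gens N) (- ?r)"
      by (simp add: algebra_simps)
    also have "\<dots> = - ?r" by (simp only: linear_neg[OF restr_orthogonal_projection(1)] r)
    finally have "restr (gens N) (- d - ?D \<omega> - ?A P + injection N) = - ?r" .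
    moreover from this have "- ?r \<in> coord_space (gens N)" by (metis restr_orthogonal_projection(3))
    ultimately show "Xi_omega N *v restr (gens N) (- d - ?D \<omega> - ?A P + injection N) = - Xg ?r"
      by (simp only: g(2) linear_neg[OF pdD(4)])
  qed
  have bal': "rd_balance N (d', P', \<psi>', \<omega>', \<mu>')" and eq': "rd_field N (d', P', \<psi>', \<omega>', \<mu>') = 0"
    using assms(8)[unfolded rd_equilibrium_def xstar] by blast+
  have eqs: "Xd (- grad_cost N d' + \<omega>' + \<mu>') = 0" "Xp (?At \<omega>') = 0" "Xq (?S \<mu>') = 0"
      "Xg (d' - injection N + ?D \<omega>' + ?A P') = 0" "Xm (- d' - ?S \<psi>' + injection N) = 0"
    using eq' residual[OF bal']
    by (simp_all add: zero_prod_def d(2) p(2)[OF transpose_mat_A_in_coord_space] q(2) m(2)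
        del: transpose_matrix_vector)
  note eq_d = inj[OF d(1) eqs(1)] and eq_P = inj[OF p(1) eqs(2)] and eq_\<psi> = inj[OF q(1) eqs(3)]
    and eq_\<omega> = inj[OF g(1) eqs(4)] and eq_\<mu> = inj[OF m(1) eqs(5)]
  \<comment> \<open>All that is needed about a single state; time enters only afterwards.\<close>
  have static: "reduce (rd_field N y) = field (h y) (w y) (z y)" "admissible u l (h y) (w y) (z y)"
      "observable (cp + cq) (z y)" "infdist y (equilibrium_set N xstar) \<le> norm (z y) + 2 * norm (w y)"
    if y: "y \<in> states N" "rd_balance N y" for y
  proof -
    obtain d P \<psi> \<omega> \<mu> where y_eq: "y = (d, P, \<psi>, \<omega>, \<mu>)" by (cases y)
    note bal = y(2)[unfolded y_eq]
    let ?r = "d - injection N + ?D \<omega> + ?A P"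
    have zy: "z y = (d - d', Lp (?A (P - P')), Lq (?S (\<psi> - \<psi>')), restr (gens N) (\<omega> - \<omega>'), \<mu> - \<mu>')"
      by (simp add: z_def xstar y_eq reduce_def linear_diff[OF restr_orthogonal_projection(1)])
    have wy: "w y = \<omega> - \<omega>'" and hy: "h y = grad_cost N d - grad_cost N d'"
      by (simp_all add: w_def h_def y_eq)
    have r: "(d - d') + ?D (\<omega> - \<omega>') + ?A (P - P') = ?r"
      using eq_\<omega> by (simp add: matrix_vector_mult_diff_distrib algebra_simps)
    have 1: "- (grad_cost N d - grad_cost N d') + (\<omega> - \<omega>') + (\<mu> - \<mu>') = - grad_cost N d + \<omega> + \<mu>"
      using eq_d by (simp add: algebra_simps)
    have 2: "?At (\<omega> - \<omega>') = ?At \<omega>" "?S (\<mu> - \<mu>') = ?S \<mu>"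
      by (simp_all add: matrix_vector_mult_diff_distrib eq_P eq_\<psi> del: transpose_matrix_vector)
    have 3: "- ((d - d') + ?S (\<psi> - \<psi>')) = - d - ?S \<psi> + injection N"
      using eq_\<mu> by (simp add: matrix_vector_mult_diff_distrib algebra_simps)
    show "reduce (rd_field N y) = field (h y) (w y) (z y)"
      unfolding zy wy hy field_def reduce_def
      by (simp only: y_eq rd_field.simps prod.case residual[OF bal] d(2) q(2) m(2) Lp Lq
          p(2)[OF transpose_mat_A_in_coord_space] r 1 2 3 linear_neg[OF pdD(5), symmetric])
    show "admissible u l (h y) (w y) (z y)"
      unfolding zy wy hy admissible_def
      using grad_cost_monotone_lipschitz[OF assms(3,6,7), of d d']
      by (simp only: prod.case Lp Lq r restr_orthogonal_projection residual_gens[OF bal] simp_thms)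
    have "norm (Lp (?A v)) \<le> (cp + cq) * norm (?A (Lp (?A v)))" for v
    proof -
      have "0 \<le> cq * norm (?A v)" using cq by simp
      then show ?thesis using cp(2)[of "?A v"] by (simp add: Lp distrib_right)
    qed
    moreover have "norm (Lq (?S v)) \<le> (cp + cq) * norm (?S (Lq (?S v)))" for v
    proof -
      have "0 \<le> cp * norm (?S v)" using cp by simp
      then show ?thesis using cq(2)[of "?S v"] by (simp add: Lq distrib_right)
    qed
    ultimately show "observable (cp + cq) (z y)" by (simp add: observable_def zy)
    \<comment> \<open>The point of the equilibrium set with the same motionless parts as the state.\<close>
    define e where "e = (d', P - Lp (?A (P - P')), \<psi> - Lq (?S (\<psi> - \<psi>')), \<omega>', \<mu>')"
    have "Lp (?A (P - P')) \<in> coord_space (lines N)"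
      using Lp(2) p(3)[OF transpose_mat_A_in_coord_space] by (metis imageE)
    moreover have "?A (P - Lp (?A (P - P'))) = ?A P'" "?S (\<psi> - Lq (?S (\<psi> - \<psi>'))) = ?S \<psi>'"
      using Lp(4)[of "P - P'"] Lq(4)[of "\<psi> - \<psi>'"] by (simp_all add: matrix_vector_mult_diff_distrib)
    ultimately have "e \<in> equilibrium_set N xstar"
      using y(1) unfolding e_def xstar y_eq by (simp add: states_def coord_space_def)
    then have "infdist y (equilibrium_set N xstar) \<le> dist y e" by (rule infdist_le)
    also have "dist y e = norm (z y + (0, 0, 0, w y - restr (gens N) (w y), 0))"
      unfolding zy wy by (simp add: dist_norm y_eq e_def)
    also have "\<dots> \<le> norm (z y) + norm (w y - restr (gens N) (w y))"
      by (rule order_trans[OF norm_triangle_ineq]) (simp add: norm_Pair)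
    also have "\<dots> \<le> norm (z y) + 2 * norm (w y)"
      using norm_triangle_ineq4[of "w y" "restr (gens N) (w y)"] restr_orthogonal_projection(2)[of "gens N" "w y"] by simp
    finally show "infdist y (equilibrium_set N xstar) \<le> norm (z y) + 2 * norm (w y)" .
  qed
  obtain \<rho> C where \<rho>: "\<rho> > 0" "C \<ge> 0" and decay: "\<forall>h w z.
    (\<forall>t\<ge>0. (z has_vector_derivative field (h t) (w t) (z t)) (at t within {0..}) \<and>
       admissible u l (h t) (w t) (z t) \<and> observable (cp + cq) (z t))
    \<longrightarrow> (\<forall>t\<ge>0. norm (z t) + 2 * norm (w t) \<le> C * norm (z 0) * exp (- \<rho> * t))"
    using exponential_decay[OF assms(3), of l "cp + cq"] by metis
  have "infdist (x t) (equilibrium_set N xstar) \<le> C * norm (z (x 0)) * exp (- \<rho> * t)"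
    if x: "rd_solution N x" and t: "t \<ge> 0" for x t
  proof -
    have sol: "x s \<in> states N" "rd_balance N (x s)"
      "((\<lambda>s. diff_part N (x s)) has_vector_derivative rd_field N (x s)) (at s within {0..})"
      if "s \<ge> 0" for s
      using x that by (auto simp: rd_solution_def)
    have "norm (z (x t)) + 2 * norm (w (x t)) \<le> C * norm (z (x 0)) * exp (- \<rho> * t)"
    proof (rule decay[rule_format, of "\<lambda>t. z (x t)" "\<lambda>t. h (x t)" "\<lambda>t. w (x t)", OF _ t], intro conjI)
      fix s :: real assume s: "s \<ge> 0"
      have "((\<lambda>s. diff_part N (x s) - diff_part N xstar) has_vector_derivative rd_field N (x s))
          (at s within {0..})"
        using has_vector_derivative_diff[OF sol(3)[OF s] has_vector_derivative_const] by simp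
      from bounded_linear.has_vector_derivative[OF lin_reduce[unfolded linear_conv_bounded_linear] this]
      show "((\<lambda>t. z (x t)) has_vector_derivative field (h (x s)) (w (x s)) (z (x s))) (at s within {0..})"
        unfolding static(1)[OF sol(1,2)[OF s], symmetric] by (simp only: z_def)
    qed (use static sol in auto)
    with static(4)[OF sol(1,2)[OF t]] show ?thesis by linarith
  qed
  with \<rho> show ?thesis by (metis mult_nonneg_nonneg norm_ge_zero)
qed

end
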